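(* Let $r>g$ be positive integers, let $H$ be the $rg$-model operator on $\ell^2(V(\mathcal{T}_{r,g}))$, let $u\in\ker(H)$ be the radially symmetric zero-energy eigenfunction centered at a red vertex given by $$u(2k-1)=0\quad(k=1,2,\ldots),\qquad u(2k)=\left(-\frac{1}{r-1}\right)^k\quad(k=0,1,\ldots),$$ where $u(n)$ denotes the constant value of $u$ on the vertices of level $n$, and let $\mathcal{S}$ be the symmetry group of the model. Then $u$ and its images under $\mathcal{S}$ span the eigenspace $\ker(H)$, in the sense that the zero vector is the only vector in $\ker(H)$ which is orthogonal to $u$ and to all of its images under $\mathcal{S}$.
   Context: The $rg$-model: let $\mathcal{G}$ be the finite graph with $r$ red vertices and $g$ green vertices and $rg$ edges, exactly one between each pair of differently colored vertices. Let $\mathcal{T}_{r,g}$ be its universal cover: the tree whose vertices are colored red or green (lifting the coloring of $\mathcal{G}$), in which every red vertex has exactly $g$ neighbors, all green, and every green vertex has exactly $r$ neighbors, all red. $H$ is the operator on $\ell^2(V(\mathcal{T}_{r,g}))$ with all $a=1$ and all $b=0$, i.e. the adjacency operator $(Hf)(v)=\sum_{w\sim v}f(w)$. Levels: fix a red vertex as center; level $n$ is the set of vertices at graph distance $n$ from it (so even levels are red and odd levels are green). A function is radially symmetric if it is constant on each level. The function $u$ in the claim lies in $\ell^2(V(\mathcal{T}_{r,g}))$ and satisfies $Hu=0$. $\mathcal{S}$ is the group of automorphisms of the tree $\mathcal{T}_{r,g}$ preserving the coloring, acting on functions by composition; it commutes with $H$, and it includes translations that map any red vertex to any other red vertex.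 *)

theory Defs
  imports "HOL-Analysis.Analysis" "HOL-Combinatorics.Permutations"
begin

section \<open>Simple graphs, trees and universal covers\<close>

record 'v sgraph =
  verts :: "'v set"
  adj :: "'v \<Rightarrow> 'v \<Rightarrow> bool"

definition simple_graph :: "'v sgraph \<Rightarrow> bool" where
  "simple_graph G \<longleftrightarrow>
     (\<forall>x y. adj G x y \<longrightarrow> x \<in> verts G \<and> y \<in> verts G \<and> x \<noteq> y \<and> adj G y x)"

definition nbrs :: "'v sgraph \<Rightarrow> 'v \<Rightarrow> 'v set" where
  "nbrs G x = {y. adj G x y}"

definition connected_graph :: "'v sgraph \<Rightarrow> bool" where
  "connected_graph G \<longleftrightarrow> verts G \<noteq> {} \<and> (\<forall>x\<in>verts G. \<forall>y\<in>verts G. (adj G)\<^sup>*\<^sup>* x y)"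

definition graph_cycle :: "'v sgraph \<Rightarrow> 'v list \<Rightarrow> bool" where
  "graph_cycle G xs \<longleftrightarrow>
     3 \<le> length xs \<and> distinct xs \<and> successively (adj G) xs \<and> adj G (last xs) (hd xs)"

definition tree :: "'v sgraph \<Rightarrow> bool" where
  "tree G \<longleftrightarrow> simple_graph G \<and> connected_graph G \<and> (\<nexists>xs. graph_cycle G xs)"

text \<open>The graph distance; only meaningful for vertices in the same component.\<close>

definition gdist :: "'v sgraph \<Rightarrow> 'v \<Rightarrow> 'v \<Rightarrow> nat" where
  "gdist G x y = (LEAST n. (adj G ^^ n) x y)"

definition level :: "'v sgraph \<Rightarrow> 'v \<Rightarrow> nat \<Rightarrow> 'v set" where
  "level G c n = {v \<in> verts G. gdist G c v = n}"

definition covering_map :: "'a sgraph \<Rightarrow> 'v sgraph \<Rightarrow> ('v \<Rightarrow> 'a) \<Rightarrow> bool" where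
  "covering_map G T p \<longleftrightarrow>
     p ` verts T = verts G \<and> (\<forall>x\<in>verts T. bij_betw p (nbrs T x) (nbrs G (p x)))"

text \<open>A universal cover of a connected graph is a covering by a tree. It is unique up to
  isomorphism; \<open>universal_cover_exists\<close> below gives existence.\<close>

definition universal_cover :: "'a sgraph \<Rightarrow> 'v sgraph \<Rightarrow> ('v \<Rightarrow> 'a) \<Rightarrow> bool" where
  "universal_cover G T p \<longleftrightarrow> tree T \<and> covering_map G T p"

section \<open>The rg-model\<close>

datatype color = Red | Green

definition rg_graph :: "nat \<Rightarrow> nat \<Rightarrow> (color \<times> nat) sgraph" where
  "rg_graph r g =
     (let V = {Red} \<times> {..<r} \<union> {Green} \<times> {..<g}
      in \<lparr>verts = V, adj = (\<lambda>x y. x \<in> V \<and> y \<in> V \<and> fst x \<noteq> fst y)\<rparr>)"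

text \<open>The coloring of the base graph, lifted along the covering map \<open>p\<close>.\<close>

definition lifted_color :: "('v \<Rightarrow> color \<times> nat) \<Rightarrow> 'v \<Rightarrow> color" where
  "lifted_color p v = fst (p v)"

text \<open>Elements of \<open>\<ell>\<^sup>2(V)\<close> are represented by functions on the whole type that vanish off \<open>V\<close>.\<close>

definition ell2 :: "'v set \<Rightarrow> ('v \<Rightarrow> complex) set" where
  "ell2 V = {f. (\<forall>v. v \<notin> V \<longrightarrow> f v = 0) \<and> (\<lambda>v. (norm (f v))\<^sup>2) summable_on V}"

definition ell2_inner :: "'v set \<Rightarrow> ('v \<Rightarrow> complex) \<Rightarrow> ('v \<Rightarrow> complex) \<Rightarrow> complex" where
  "ell2_inner V f h = (\<Sum>\<^sub>\<infinity>v\<in>V. cnj (f v) * h v)"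

text \<open>Intended for locally finite graphs only, as the sum over an infinite set of neighbors
  would be \<open>0\<close>.\<close>

definition adj_op :: "'v sgraph \<Rightarrow> ('v \<Rightarrow> complex) \<Rightarrow> 'v \<Rightarrow> complex" where
  "adj_op T f v = (\<Sum>w\<in>nbrs T v. f w)"

definition ker_adj_op :: "'v sgraph \<Rightarrow> ('v \<Rightarrow> complex) set" where
  "ker_adj_op T = {f \<in> ell2 (verts T). \<forall>v\<in>verts T. adj_op T f v = 0}"

text \<open>The automorphisms of the tree that preserve the lifted coloring. Being extended by the
  identity off the vertex set, they act on \<open>ell2 (verts T)\<close> by \<open>f \<mapsto> f \<circ> \<sigma>\<close>. They need not
  commute with \<open>p\<close>.\<close>

definition rg_symmetries :: "'v sgraph \<Rightarrow> ('v \<Rightarrow> color \<times> nat) \<Rightarrow> ('v \<Rightarrow> 'v) set" where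
  "rg_symmetries T p =
     {\<sigma>. \<sigma> permutes verts T \<and>
         (\<forall>x\<in>verts T. \<forall>y\<in>verts T. adj T (\<sigma> x) (\<sigma> y) \<longleftrightarrow> adj T x y) \<and>
         (\<forall>x\<in>verts T. lifted_color p (\<sigma> x) = lifted_color p x)}"

section \<open>Existence of universal covers\<close>

text \<open>Non-backtracking walks ending at \<open>b\<close>, listed from the current vertex back to \<open>b\<close>.\<close>

inductive_set nb_walks :: "'v sgraph \<Rightarrow> 'v \<Rightarrow> 'v list set" for G b where
  base: "[b] \<in> nb_walks G b"
| first: "adj G b a \<Longrightarrow> [a, b] \<in> nb_walks G b"
| step: "x # y # xs \<in> nb_walks G b \<Longrightarrow> adj G x a \<Longrightarrow> a \<noteq> y \<Longrightarrow> a # x # y # xs \<in> nb_walks G b"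

definition nb_tree :: "'v sgraph \<Rightarrow> 'v \<Rightarrow> 'v list sgraph" where
  "nb_tree G b = \<lparr>verts = nb_walks G b,
     adj = (\<lambda>u v. u \<in> nb_walks G b \<and> v \<in> nb_walks G b \<and> (u = tl v \<or> v = tl u))\<rparr>"

lemma nb_walks_nonempty: "u \<in> nb_walks G b \<Longrightarrow> u \<noteq> []"
  by (induction rule: nb_walks.induct) auto

lemma nb_walks_singleton: "[x] \<in> nb_walks G b \<longleftrightarrow> x = b"
  by (auto elim: nb_walks.cases intro: nb_walks.intros)

lemma nb_walks_Cons2:
  "a # x # xs \<in> nb_walks G b \<longleftrightarrow>
     x # xs \<in> nb_walks G b \<and> adj G x a \<and> (xs \<noteq> [] \<longrightarrow> a \<noteq> hd xs)" (is "?L \<longleftrightarrow> ?R")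
proof
  show ?R if ?L using that by cases (auto intro: nb_walks.intros)
  show ?L if ?R
    using that by (cases xs) (auto simp: nb_walks_singleton intro: nb_walks.intros)
qed

lemma nbrs_nb_tree:
  assumes "u \<in> nb_walks G b"
  shows "nbrs (nb_tree G b) u =
     (if tl u = [] then {} else {tl u}) \<union>
     {a # u |a. adj G (hd u) a \<and> (tl u \<noteq> [] \<longrightarrow> a \<noteq> hd (tl u))}" (is "_ = ?R")
proof (rule set_eqI)
  fix v
  obtain x xs where u: "u = x # xs" using nb_walks_nonempty[OF assms] by (cases u) auto
  have "v \<in> nbrs (nb_tree G b) u \<longleftrightarrow> v \<in> nb_walks G b \<and> (v = xs \<or> tl v = x # xs)"
    using assms u by (auto simp: nbrs_def nb_tree_def)
  also have "\<dots> \<longleftrightarrow> v \<in> ?R"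
  proof (cases xs)
    case Nil
    then show ?thesis using assms u nb_walks_nonempty[of v]
      by (cases v) (auto simp: nb_walks_Cons2)
  next
    case (Cons y ys)
    then show ?thesis using assms u nb_walks_nonempty[of v]
      by (cases v) (auto simp: nb_walks_Cons2)
  qed
  finally show "v \<in> nbrs (nb_tree G b) u \<longleftrightarrow> v \<in> ?R" .
qed

lemma nb_walks_verts:
  assumes "simple_graph G" "b \<in> verts G" "u \<in> nb_walks G b"
  shows "hd u \<in> verts G" "tl u \<noteq> [] \<Longrightarrow> adj G (hd u) (hd (tl u))"
  using assms(3,1,2) by (induction rule: nb_walks.induct) (auto simp: simple_graph_def)

lemma nb_tree_local_bij:
  assumes "simple_graph G" "b \<in> verts G" "u \<in> nb_walks G b"
  shows "bij_betw hd (nbrs (nb_tree G b) u) (nbrs G (hd u))"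
  unfolding nbrs_nb_tree[OF assms(3)] bij_betw_def
  using nb_walks_verts(2)[OF assms]
  by (auto simp: inj_on_def nbrs_def image_iff split: if_splits) (metis list.sel(1))+

lemma simple_nb_tree: "simple_graph (nb_tree G b)"
proof -
  have "u \<noteq> tl u" if "u \<in> nb_walks G b" for u
    using nb_walks_nonempty[OF that] by (cases u) auto
  then show ?thesis by (fastforce simp: simple_graph_def nb_tree_def)
qed

lemma connected_nb_tree: "connected_graph (nb_tree G b)"
proof -
  let ?E = "adj (nb_tree G b)"
  have sym: "?E\<^sup>*\<^sup>* v u" if "?E\<^sup>*\<^sup>* u v" for u v
    using that symp_rtranclp[of ?E] by (auto simp: symp_def nb_tree_def)
  have root: "?E\<^sup>*\<^sup>* u [b]" if "u \<in> nb_walks G b" for u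
    using that
  proof (induction rule: nb_walks.induct)
    case (first a)
    then show ?case by (intro r_into_rtranclp) (auto simp: nb_tree_def intro: nb_walks.intros)
  next
    case (step x y xs a)
    then have "?E (a # x # y # xs) (x # y # xs)"
      by (auto simp: nb_tree_def intro: nb_walks.intros)
    then show ?case using step by (meson converse_rtranclp_into_rtranclp)
  qed auto
  show ?thesis
    unfolding connected_graph_def
    using root sym by (auto simp: nb_tree_def intro: nb_walks.base)
      (metis (no_types, lifting) rtranclp_trans)
qed

lemma nb_tree_acyclic: "\<not> graph_cycle (nb_tree G b) xs"
proof
  let ?n = "length xs"
  assume c: "graph_cycle (nb_tree G b) xs"
  then have n: "?n \<ge> 3" and d: "distinct xs" and s: "successively (adj (nb_tree G b)) xs"
    and l: "adj (nb_tree G b) (last xs) (hd xs)"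
    by (auto simp: graph_cycle_def)
  have adj: "adj (nb_tree G b) (xs ! i) (xs ! (Suc i mod ?n))" if "i < ?n" for i
  proof (cases "Suc i = ?n")
    case True
    then have "i = ?n - 1" "xs \<noteq> []" by auto
    then show ?thesis using l True by (simp add: last_conv_nth hd_conv_nth)
  next
    case False
    then show ?thesis using s that by (simp add: successively_conv_nth)
  qed
  obtain i where i: "i < ?n" "\<And>j. j < ?n \<Longrightarrow> length (xs ! j) \<le> length (xs ! i)"
  proof -
    let ?L = "(\<lambda>j. length (xs ! j)) ` {..<?n}"
    have "Max ?L \<in> ?L" using n by (intro Max_in) (auto simp: lessThan_empty_iff)
    then obtain i where "i < ?n" "length (xs ! i) = Max ?L" by force
    then show ?thesis using that by simp
  qed
  define k where "k = (if i = 0 then ?n - 1 else i - 1)"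
  have k: "k < ?n" "Suc k mod ?n = i" using n i by (auto simp: k_def)
  have m: "Suc i mod ?n < ?n" using n by (intro mod_less_divisor) linarith
  have km: "k \<noteq> Suc i mod ?n"
    using n i(1) by (cases "Suc i = ?n") (auto simp: k_def split: if_splits)
  have parent: "v = tl u"
    if "adj (nb_tree G b) u v \<or> adj (nb_tree G b) v u" "length v \<le> length u" for u v
  proof -
    have "v \<noteq> []" "u \<noteq> []" "u = tl v \<or> v = tl u"
      using that nb_walks_nonempty[of u G b] nb_walks_nonempty[of v G b]
      by (auto simp: nb_tree_def)
    then show ?thesis using that(2) by (cases v) auto
  qed
  have "xs ! (Suc i mod ?n) = tl (xs ! i)" using parent adj[OF i(1)] i(2)[OF m] by blast
  moreover have "xs ! k = tl (xs ! i)" using parent adj[OF k(1)] i(2)[OF k(1)] k(2) by auto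
  ultimately show False using nth_eq_iff_index_eq[OF d k(1) m] km by simp
qed

lemma universal_cover_exists:
  fixes G :: "'v sgraph"
  assumes "simple_graph G" "connected_graph G"
  shows "\<exists>(T :: 'v list sgraph) p. universal_cover G T p"
proof -
  obtain b where b: "b \<in> verts G" using assms(2) by (auto simp: connected_graph_def)
  have bij: "bij_betw hd (nbrs (nb_tree G b) u) (nbrs G (hd u))" if "u \<in> nb_walks G b" for u
    using nb_tree_local_bij[OF assms(1) b that] .
  have "x \<in> hd ` nb_walks G b" if "x \<in> verts G" for x
  proof -
    have "(adj G)\<^sup>*\<^sup>* b x" using assms(2) b that by (auto simp: connected_graph_def)
    then show ?thesis
    proof induction
      case base
      show ?case by (rule image_eqI[of _ _ "[b]"]) (auto intro: nb_walks.base)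
    next
      case (step y z)
      then obtain u where u: "u \<in> nb_walks G b" "hd u = y" by auto
      then have "z \<in> hd ` nbrs (nb_tree G b) u"
        using bij[OF u(1)] step by (auto simp: bij_betw_def nbrs_def)
      then show ?case by (auto simp: nbrs_def nb_tree_def)
    qed
  qed
  then have "covering_map G (nb_tree G b) hd"
    using bij nb_walks_verts(1)[OF assms(1) b] by (auto simp: covering_map_def nb_tree_def)
  moreover have "tree (nb_tree G b)"
    by (simp add: tree_def simple_nb_tree connected_nb_tree nb_tree_acyclic)
  ultimately show ?thesis unfolding universal_cover_def by blast
qed

lemma rg_graph_simple: "simple_graph (rg_graph r g)"
  by (auto simp: simple_graph_def rg_graph_def Let_def)

lemma rg_graph_connected:
  assumes "0 < r" "0 < g"
  shows "connected_graph (rg_graph r g)"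
proof -
  let ?E = "adj (rg_graph r g)"
  have r0: "(Red, 0) \<in> verts (rg_graph r g)" and g0: "(Green, 0) \<in> verts (rg_graph r g)"
    using assms by (auto simp: rg_graph_def Let_def)
  have E: "?E x y" if "x \<in> verts (rg_graph r g)" "y \<in> verts (rg_graph r g)" "fst x \<noteq> fst y" for x y
    using that by (auto simp: rg_graph_def Let_def)
  have "?E\<^sup>*\<^sup>* x y" if x: "x \<in> verts (rg_graph r g)" and y: "y \<in> verts (rg_graph r g)" for x y
  proof (cases "fst x = fst y")
    case False
    then show ?thesis using E x y by blast
  next
    case True
    obtain z where z: "z \<in> verts (rg_graph r g)" "fst z \<noteq> fst x"
      using r0 g0 by (cases "fst x") force+
    then have "?E x z" "?E z y" using E x y True by auto
    then show ?thesis by (meson converse_rtranclp_into_rtranclp r_into_rtranclp)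
  qed
  then show ?thesis using r0 by (auto simp: connected_graph_def)
qed

end

theory Submission
  imports Defs
begin

text \<open>If \<open>H w = 0\<close>, then the sums of \<open>w\<close> over the even levels around a vertex \<open>x\<close> satisfy a
  first-order recursion, so each of them is an explicit multiple of \<open>w x\<close>. For green \<open>x\<close> the
  multiples are so large compared with the sizes of the levels that the Cauchy-Schwarz inequality
  bounds the \<open>\<ell>\<^sup>2\<close> norm of \<open>w\<close> on every even level below by \<open>|w x|\<close>; hence \<open>w\<close> vanishes on green
  vertices. For red \<open>x\<close> they yield \<open>\<langle>u\<^sub>x, w\<rangle> = \<parallel>u\<^sub>x\<parallel>\<^sup>2 w x\<close>, where \<open>u\<^sub>x\<close> is the radial function centered
  at \<open>x\<close>. Since the symmetries act transitively on the red vertices, \<open>u\<^sub>x\<close> is one of the images of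
  \<open>u\<close>, so orthogonality forces \<open>w x = 0\<close>.\<close>

section \<open>Semiregular trees\<close>

text \<open>The degrees are not ordered, so one tree can be treated twice: with the red vertices as
  \<open>A\<close> and with the green ones as \<open>A\<close>. Counts and level recursions below
  take the root in \<open>A\<close>.\<close>

locale semiregular_tree =
  fixes T :: "'v sgraph" and A :: "'v set" and d e :: nat
  assumes tree: "tree T"
    and alternating: "adj T x y \<Longrightarrow> x \<in> A \<longleftrightarrow> y \<notin> A"
    and card_nbrs_in: "x \<in> verts T \<Longrightarrow> x \<in> A \<Longrightarrow> card (nbrs T x) = d"
    and card_nbrs_out: "x \<in> verts T \<Longrightarrow> x \<notin> A \<Longrightarrow> card (nbrs T x) = e"
    and d_pos: "0 < d" and e_pos: "0 < e"
begin

definition children :: "'v \<Rightarrow> 'v \<Rightarrow> 'v set" where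
  "children c v = {w \<in> nbrs T v. gdist T c w = Suc (gdist T c v)}"

section \<open>Graph distance in a two-colored tree\<close>

lemma adj_sym: "adj T x y \<Longrightarrow> adj T y x"
  and adj_verts: "adj T x y \<Longrightarrow> x \<in> verts T" "adj T x y \<Longrightarrow> y \<in> verts T"
  using tree by (auto simp: tree_def simple_graph_def)

text \<open>Infinite sets have \<open>card\<close> 0, so positive degrees force finiteness.\<close>

lemma finite_nbrs: "x \<in> verts T \<Longrightarrow> finite (nbrs T x)"
  using card_nbrs_in[of x] card_nbrs_out[of x] d_pos e_pos
  by (metis card.infinite less_not_refl)

lemma finite_children: "v \<in> verts T \<Longrightarrow> finite (children c v)"
  using finite_nbrs[of v] by (simp add: children_def)

lemma walk_exists: "x \<in> verts T \<Longrightarrow> y \<in> verts T \<Longrightarrow> \<exists>n. (adj T ^^ n) x y"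
  using tree by (auto simp: tree_def connected_graph_def dest: rtranclp_imp_relpowp)

lemma walk_gdist: "x \<in> verts T \<Longrightarrow> y \<in> verts T \<Longrightarrow> (adj T ^^ gdist T x y) x y"
  unfolding gdist_def by (metis walk_exists LeastI_ex)

lemma gdist_le_walk: "(adj T ^^ n) x y \<Longrightarrow> gdist T x y \<le> n"
  unfolding gdist_def by (rule Least_le)

lemma gdist_self: "gdist T x x = 0"
  using gdist_le_walk[of 0 x x] by simp

lemma gdist_eq_0: "x \<in> verts T \<Longrightarrow> y \<in> verts T \<Longrightarrow> gdist T x y = 0 \<longleftrightarrow> x = y"
  using walk_gdist[of x y] gdist_self by auto

lemma gdist_adj_le: "x \<in> verts T \<Longrightarrow> adj T y z \<Longrightarrow> gdist T x z \<le> Suc (gdist T x y)"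
  using walk_gdist[of x y] adj_verts[of y z] by (intro gdist_le_walk) auto

lemma walk_color: "(adj T ^^ n) x y \<Longrightarrow> even n \<longleftrightarrow> (x \<in> A \<longleftrightarrow> y \<in> A)"
  by (induction n arbitrary: y) (auto dest: alternating)

lemma even_gdist: "x \<in> verts T \<Longrightarrow> y \<in> verts T \<Longrightarrow> even (gdist T x y) \<longleftrightarrow> (x \<in> A \<longleftrightarrow> y \<in> A)"
  using walk_color[OF walk_gdist] by blast

text \<open>Neighbors have opposite colors, so parity excludes equal distances.\<close>

lemma gdist_adj:
  assumes "x \<in> verts T" "adj T y z"
  shows "gdist T x z = Suc (gdist T x y) \<or> gdist T x y = Suc (gdist T x z)"
proof -
  have "even (gdist T x y) \<noteq> even (gdist T x z)"
    using assms even_gdist alternating adj_verts by metis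
  moreover have "gdist T x z \<le> Suc (gdist T x y)" "gdist T x y \<le> Suc (gdist T x z)"
    using gdist_adj_le assms adj_sym by auto
  ultimately show ?thesis
    by (metis Suc_le_eq le_antisym not_less_eq_eq)
qed

section \<open>Parents and children with respect to a root\<close>

lemma parent_exists:
  assumes "x \<in> verts T" "y \<in> verts T" "gdist T x y = Suc n"
  shows "\<exists>z. adj T z y \<and> gdist T x z = n"
proof -
  have "(adj T ^^ Suc n) x y" using walk_gdist assms by metis
  then obtain z where z: "(adj T ^^ n) x z" "adj T z y" by auto
  then have "gdist T x z \<le> n" using gdist_le_walk by blast
  moreover have "Suc n \<le> Suc (gdist T x z)" using gdist_adj_le[OF assms(1) z(2)] assms(3) by simp
  ultimately show ?thesis using z by auto
qed

text \<open>Pass to parents from both ends until they coincide. The distance bound is what later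
  allows the path to be closed to a cycle through a vertex of the next level.\<close>

lemma path_below_level:
  assumes "c \<in> verts T" "a \<in> level T c n" "b \<in> level T c n" "a \<noteq> b"
  shows "\<exists>xs. distinct xs \<and> successively (adj T) xs \<and> hd xs = a \<and> last xs = b \<and>
    2 \<le> length xs \<and> (\<forall>x\<in>set xs. gdist T c x \<le> n)"
  using assms(2-4)
proof (induction n arbitrary: a b)
  case 0
  then show ?case using gdist_eq_0[OF assms(1)] by (auto simp: level_def)
next
  case (Suc n)
  obtain a' b' where a': "adj T a' a" "gdist T c a' = n" and b': "adj T b' b" "gdist T c b' = n"
    using Suc.prems parent_exists[OF assms(1)] unfolding level_def by blast
  have lev: "gdist T c a = Suc n" "gdist T c b = Suc n" using Suc.prems by (auto simp: level_def)
  show ?case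
  proof (cases "a' = b'")
    case True
    then show ?thesis using a' b' lev Suc.prems
      by (intro exI[of _ "[a, a', b]"]) (auto intro: adj_sym)
  next
    case False
    moreover have "a' \<in> level T c n" "b' \<in> level T c n"
      using a' b' adj_verts by (auto simp: level_def)
    ultimately obtain xs where xs: "distinct xs" "successively (adj T) xs" "hd xs = a'"
      "last xs = b'" "2 \<le> length xs" "\<forall>x\<in>set xs. gdist T c x \<le> n"
      using Suc.IH by blast
    \<comment> \<open>\<open>a\<close> and \<open>b\<close> lie one level beyond the bound on
      \<open>xs\<close>, so adding them keeps the path simple.\<close>
    then have "a \<notin> set xs" "b \<notin> set xs" "xs \<noteq> []" using lev by auto
    with xs lev a' b' Suc.prems show ?thesis
      by (intro exI[of _ "a # xs @ [b]"])
        (auto simp: successively_Cons successively_append_iff intro: adj_sym le_SucI)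
  qed
qed

text \<open>A path between two parents that stays within their level avoids \<open>v\<close>; adding
  \<open>v\<close> would close it to a cycle.\<close>

lemma parent_unique:
  assumes "c \<in> verts T" "adj T a v" "adj T b v"
    "gdist T c v = Suc (gdist T c a)" "gdist T c v = Suc (gdist T c b)"
  shows "a = b"
proof (rule ccontr)
  assume "a \<noteq> b"
  moreover have "a \<in> level T c (gdist T c a)" "b \<in> level T c (gdist T c a)"
    using assms adj_verts by (auto simp: level_def)
  ultimately obtain xs where xs: "distinct xs" "successively (adj T) xs" "hd xs = a"
      "last xs = b" "2 \<le> length xs" "\<forall>x\<in>set xs. gdist T c x \<le> gdist T c a"
    using path_below_level[OF assms(1)] by blast
  then have "v \<notin> set xs" "xs \<noteq> []" using assms by auto
  then have "graph_cycle T (v # xs)"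
    using xs assms adj_sym by (auto simp: graph_cycle_def successively_Cons)
  then show False using tree by (auto simp: tree_def)
qed

lemma nbrs_root: "c \<in> verts T \<Longrightarrow> nbrs T c = children c c"
  using gdist_adj[of c c] by (auto simp: children_def nbrs_def gdist_self)

lemma nbrs_child:
  assumes "c \<in> verts T" "v \<in> children c y"
  shows "nbrs T v = insert y (children c v)" "y \<notin> children c v"
proof -
  have y: "adj T y v" "gdist T c v = Suc (gdist T c y)"
    using assms by (auto simp: children_def nbrs_def)
  have "z = y \<or> gdist T c z = Suc (gdist T c v)" if "adj T v z" for z
    using gdist_adj[OF assms(1) that] parent_unique[OF assms(1) adj_sym[OF that] y(1)] y(2) by auto
  then show "nbrs T v = insert y (children c v)"
    using y adj_sym by (auto simp: children_def nbrs_def)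
  show "y \<notin> children c v" using y by (auto simp: children_def)
qed

lemma children_verts: "v \<in> children c y \<Longrightarrow> v \<in> verts T" "v \<in> children c y \<Longrightarrow> y \<in> verts T"
  using adj_verts by (auto simp: children_def nbrs_def)

text \<open>Every vertex except the root loses exactly one neighbor, its parent.\<close>

lemma card_children:
  assumes "c \<in> verts T" "v \<in> verts T"
  shows "card (children c v) = (if v \<in> A then d else e) - (if v = c then 0 else 1)"
proof (cases "v = c")
  case True
  then show ?thesis
    using card_nbrs_in[OF assms(2)] card_nbrs_out[OF assms(2)] nbrs_root[OF assms(1)] by simp
next
  case False
  then obtain n where "gdist T c v = Suc n"
    using gdist_eq_0[OF assms] not0_implies_Suc by auto
  then obtain y where "v \<in> children c y"
    using parent_exists[OF assms] by (fastforce simp: children_def nbrs_def)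
  note nbrs_child[OF assms(1) this]
  then have "card (nbrs T v) = Suc (card (children c v))"
    using finite_children[OF assms(2)] by simp
  then show ?thesis using False card_nbrs_in[OF assms(2)] card_nbrs_out[OF assms(2)] by auto
qed

section \<open>Sums over levels\<close>

lemma level_0: "c \<in> verts T \<Longrightarrow> level T c 0 = {c}"
  using gdist_eq_0[of c] by (auto simp: level_def)

lemma level_Suc:
  assumes "c \<in> verts T"
  shows "level T c (Suc n) = (\<Union>v\<in>level T c n. children c v)"
  using parent_exists[OF assms] adj_verts
  by (fastforce simp: level_def children_def nbrs_def)

lemma children_disjoint:
  "c \<in> verts T \<Longrightarrow> v \<in> children c y \<Longrightarrow> v \<in> children c z \<Longrightarrow> y = z"
  using parent_unique by (auto simp: children_def nbrs_def)

lemma finite_level: "c \<in> verts T \<Longrightarrow> finite (level T c n)"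
proof (induction n)
  case (Suc n)
  then show ?case by (auto simp: level_Suc intro: finite_children) (auto simp: level_def intro: finite_children)
qed (simp add: level_0)

lemma sum_level_Suc:
  assumes "c \<in> verts T"
  shows "sum f (level T c (Suc n)) = (\<Sum>v\<in>level T c n. sum f (children c v))"
  unfolding level_Suc[OF assms]
  using finite_level[OF assms] finite_children children_disjoint[OF assms]
  by (intro sum.UNION_disjoint) (auto simp: level_def)

lemma level_color:
  "c \<in> verts T \<Longrightarrow> v \<in> level T c n \<Longrightarrow> v \<in> A \<longleftrightarrow> (c \<in> A \<longleftrightarrow> even n)"
  using even_gdist[of c v] by (auto simp: level_def)

text \<open>The number of children of a vertex on level \<open>n\<close> around a root in
  \<open>A\<close>. It depends on the level alone; the root is the exception in having no
  parent.\<close>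

definition branching :: "nat \<Rightarrow> nat" where
  "branching n = (if even n then d else e) - (if n = 0 then 0 else 1)"

lemma card_children_level:
  assumes "c \<in> verts T" "c \<in> A" "v \<in> level T c n"
  shows "card (children c v) = branching n"
proof -
  have "v = c \<longleftrightarrow> n = 0" using assms gdist_eq_0[of c v] by (auto simp: level_def)
  moreover have "v \<in> verts T" using assms by (simp add: level_def)
  ultimately show ?thesis
    using card_children[of c v] level_color[OF assms(1,3)] assms by (simp add: branching_def)
qed

lemma card_level_Suc:
  assumes "c \<in> verts T" "c \<in> A"
  shows "card (level T c (Suc n)) = branching n * card (level T c n)"
  using sum_level_Suc[OF assms(1), of "\<lambda>_. 1 :: nat" n] card_children_level[OF assms] by simp

text \<open>The kernel equation at a child \<open>v\<close> of \<open>y\<close> says that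
  \<open>w\<close> sums to \<open>- w y\<close> over the children of \<open>v\<close>, and each
  \<open>y\<close> has \<open>branching n\<close> such children.\<close>

lemma sum_level_kernel:
  assumes "c \<in> verts T" "c \<in> A" "even n"
    and ker: "\<And>v. v \<in> verts T \<Longrightarrow> v \<notin> A \<Longrightarrow> adj_op T w v = 0"
  shows "sum w (level T c (Suc (Suc n))) = - of_nat (branching n) * sum w (level T c n)"
proof -
  have "sum w (children c v) = - w y" if "y \<in> level T c n" "v \<in> children c y" for y v
  proof -
    have "v \<in> level T c (Suc n)" using that level_Suc[OF assms(1)] by blast
    then have "v \<notin> A" "v \<in> verts T" using level_color[OF assms(1)] assms by (auto simp: level_def)
    then show ?thesis
      using ker[of v] nbrs_child[OF assms(1) that(2)] finite_children[of v c]
      by (simp add: adj_op_def add_eq_0_iff)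
  qed
  then have "sum w (level T c (Suc (Suc n))) = (\<Sum>y\<in>level T c n. \<Sum>v\<in>children c y. - w y)"
    unfolding sum_level_Suc[OF assms(1)] by simp
  also have "\<dots> = (\<Sum>y\<in>level T c n. - of_nat (branching n) * w y)"
    using card_children_level[OF assms(1,2)] by (intro sum.cong) simp_all
  finally show ?thesis by (simp add: sum_distrib_left)
qed

text \<open>The levels partition the vertices into finite sets, so the sum can be regrouped over
  pairs of a level number and a vertex.\<close>

lemma has_sum_levels:
  fixes f :: "'v \<Rightarrow> 'b::banach"
  assumes "c \<in> verts T" "f summable_on verts T"
  shows "((\<lambda>n. sum f (level T c n)) has_sum infsum f (verts T)) UNIV"
proof (rule has_sum_SigmaD[where B = "level T c" and f = "\<lambda>x. f (snd x)"])
  have "bij_betw snd (Sigma (UNIV :: nat set) (level T c)) (verts T)"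
    by (auto simp: bij_betw_def inj_on_def level_def image_iff)
  then show "((\<lambda>x. f (snd x)) has_sum infsum f (verts T)) (Sigma UNIV (level T c))"
    using assms by (simp add: has_sum_reindex_bij_betw)
qed (use finite_level[OF assms(1)] in \<open>auto intro: has_sum_finite\<close>)

lemma nonneg_summable_on_levels:
  fixes f :: "'v \<Rightarrow> real"
  assumes "c \<in> verts T" "\<And>v. 0 \<le> f v" "summable (\<lambda>n. sum f (level T c n))"
  shows "f summable_on verts T"
proof -
  have "(\<lambda>x. norm (f (snd x))) summable_on Sigma UNIV (level T c)"
    unfolding Infinite_Sum.abs_summable_on_Sigma_iff
    using assms finite_level[OF assms(1)]
    by (simp add: sum_nonneg summable_on_UNIV_nonneg_real_iff)
  moreover have bij: "bij_betw snd (Sigma (UNIV :: nat set) (level T c)) (verts T)"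
    by (auto simp: bij_betw_def inj_on_def level_def image_iff)
  ultimately show ?thesis
    using assms(2) summable_on_reindex_bij_betw[OF bij, of f] by simp
qed

section \<open>Kernel functions\<close>

text \<open>Two levels further out, the sum of \<open>w\<close> is scaled by
  \<open>branching (2 * k)\<close> in modulus, while the level grows by at most the square of that
  factor because \<open>e \<le> d\<close>. Cauchy-Schwarz then keeps the squared norm on every even
  level at least that of \<open>w c\<close>, so the norms cannot be summable unless
  \<open>w c = 0\<close>.\<close>

lemma kernel_vanishes_at_larger_degree:
  assumes c: "c \<in> verts T" "c \<in> A" and "e \<le> d" "2 \<le> d"
    and w: "w \<in> ker_adj_op T"
  shows "w c = 0"
proof (rule ccontr)
  assume "w c \<noteq> 0"
  let ?L = "\<lambda>k. level T c (2 * k)"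
  let ?s = "\<lambda>n. \<Sum>v\<in>level T c n. (norm (w v))\<^sup>2"
  \<comment> \<open>\<open>D\<close> is the product of the \<open>branching (2 * j)\<close> for
    \<open>j < k\<close>.\<close>
  have coeff: "\<exists>D. 0 < D \<and> sum w (?L k) = (- 1) ^ k * of_nat D * w c \<and> card (?L k) \<le> D\<^sup>2" for k
  proof (induction k)
    case 0
    show ?case by (intro exI[of _ 1]) (simp add: level_0 c)
  next
    case (Suc k)
    then obtain D where D: "0 < D" "sum w (?L k) = (- 1) ^ k * of_nat D * w c"
        "card (?L k) \<le> D\<^sup>2" by blast
    let ?b = "branching (2 * k)"
    \<comment> \<open>The odd levels branch by \<open>e - 1\<close>, the even ones by
      \<open>d\<close> or \<open>d - 1\<close>; \<open>2 \<le> d\<close> makes the latter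
      positive.\<close>
    have b: "0 < ?b" "branching (Suc (2 * k)) \<le> ?b"
      using assms(3,4) by (auto simp: branching_def)
    have "sum w (?L (Suc k)) = - of_nat ?b * sum w (?L k)"
      using sum_level_kernel[OF c, of "2 * k" w] w by (simp add: ker_adj_op_def)
    moreover have "card (?L (Suc k)) \<le> (?b * D)\<^sup>2"
    proof -
      have "card (?L (Suc k)) = branching (Suc (2 * k)) * ?b * card (?L k)"
        by (simp add: card_level_Suc[OF c])
      also have "\<dots> \<le> ?b * ?b * D\<^sup>2" using b D by (intro mult_mono) auto
      finally show ?thesis by (simp add: power2_eq_square algebra_simps)
    qed
    ultimately show ?case using b D by (intro exI[of _ "?b * D"]) simp
  qed
  have lower: "(norm (w c))\<^sup>2 \<le> ?s (2 * k)" for k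
  proof -
    obtain D where D: "0 < D" "sum w (?L k) = (- 1) ^ k * of_nat D * w c" "card (?L k) \<le> D\<^sup>2"
      using coeff by blast
    have "(real D)\<^sup>2 * (norm (w c))\<^sup>2 = (norm (sum w (?L k)))\<^sup>2"
      by (simp add: D norm_mult norm_power power_mult_distrib)
    also have "\<dots> \<le> (\<Sum>v\<in>?L k. norm (w v))\<^sup>2" by (intro power_mono norm_sum) simp
    also have "\<dots> \<le> ?s (2 * k) * real (card (?L k))" by (rule sum_squared_le_sum_of_squares)
    also have "\<dots> \<le> ?s (2 * k) * (real D)\<^sup>2"
      using D(3) by (intro mult_left_mono sum_nonneg) (simp_all flip: of_nat_power)
    finally show ?thesis using D(1) by (simp add: mult.commute)
  qed
  have "(\<lambda>v. (norm (w v))\<^sup>2) summable_on verts T" using w by (simp add: ker_adj_op_def ell2_def)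
  then have "summable ?s"
    using has_sum_levels[OF c(1)] has_sum_imp_sums sums_iff by blast
  then have "?s \<longlonglongrightarrow> 0" by (rule summable_LIMSEQ_zero)
  then have "(\<lambda>k. ?s (2 * k)) \<longlonglongrightarrow> 0"
    by (rule LIMSEQ_subseq_LIMSEQ[unfolded o_def]) (simp add: strict_mono_def)
  then have "(norm (w c))\<^sup>2 \<le> 0" using lower by (intro LIMSEQ_le_const) auto
  then show False using \<open>w c \<noteq> 0\<close> by simp
qed

section \<open>The radial kernel function\<close>

definition radial_coeff :: "nat \<Rightarrow> complex" where
  "radial_coeff n = (if even n then (- (1 / (of_nat e - 1))) ^ (n div 2) else 0)"

text \<open>With \<open>A\<close> the red vertices and \<open>e = r\<close> this is the function
  \<open>u\<close> of the theorem, with an arbitrary center. The number \<open>e - 1\<close> in its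
  coefficients counts the children of a vertex on an odd level.\<close>

definition radial :: "'v \<Rightarrow> 'v \<Rightarrow> complex" where
  "radial c v = (if v \<in> verts T then radial_coeff (gdist T c v) else 0)"

lemma radial_level: "v \<in> level T c n \<Longrightarrow> radial c v = radial_coeff n"
  by (simp add: level_def radial_def)

lemma cnj_radial: "cnj (radial c v) = radial c v"
  by (simp add: radial_def radial_coeff_def)

lemma radial_coeff_step:
  "radial_coeff (Suc (Suc n)) = - radial_coeff n / (of_nat e - 1)"
  by (simp add: radial_coeff_def)

text \<open>From one even level to the next, beyond the root, the level grows by
  \<open>(e - 1) * (d - 1)\<close> and the squared value shrinks by \<open>(e - 1)\<close> squared.
  The norms are thus geometric with ratio \<open>(d - 1) / (e - 1) < 1\<close>.\<close>

lemma radial_ell2: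
  assumes c: "c \<in> verts T" "c \<in> A" and "d < e"
  shows "radial c \<in> ell2 (verts T)"
proof -
  let ?s = "\<lambda>n. \<Sum>v\<in>level T c n. (norm (radial c v))\<^sup>2"
  let ?q = "real (d - 1) / real (e - 1)"
  have s: "?s n = real (card (level T c n)) * (norm (radial_coeff n))\<^sup>2" for n
    by (simp add: radial_level)
  have nrm: "norm (of_nat e - 1 :: complex) = real (e - 1)"
    using e_pos by (metis Suc_leI norm_of_nat of_nat_1 of_nat_diff One_nat_def)
  \<comment> \<open>Level 0 is excluded because the root has \<open>d\<close> children instead of
    \<open>d - 1\<close>.\<close>
  have step: "?s (Suc (Suc n)) = ?q * ?s n" if "0 < n" for n
  proof (cases "even n")
    case True
    have "0 < e - 1" using d_pos \<open>d < e\<close> by simp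
    moreover have "card (level T c (Suc (Suc n))) = (e - 1) * (d - 1) * card (level T c n)"
      using True that by (simp add: card_level_Suc[OF c] branching_def)
    ultimately show ?thesis unfolding s radial_coeff_step norm_divide norm_minus_cancel nrm
      by (simp add: power2_eq_square del: of_nat_diff)
  qed (auto simp: s radial_coeff_def)
  have q: "0 \<le> ?q" "?q < 1" using \<open>d < e\<close> d_pos by auto
  have "?s (2 * k + 2) = ?q ^ k * ?s 2" for k
  proof (induction k)
    case (Suc k)
    then show ?case using step[of "2 * k + 2"] by simp
  qed (simp add: numeral_2_eq_2)
  then have even: "summable (\<lambda>k. ?s (2 * k + 2))"
    using q by (simp add: summable_geometric summable_mult2)
  have "summable ?s"
  proof -
    have "summable (\<lambda>k. ?s (2 * k))"
      using even summable_Suc_iff[of "\<lambda>k. ?s (2 * k)"] by simp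
    moreover have "strict_mono (\<lambda>k::nat. 2 * k)" by (simp add: strict_mono_def)
    moreover have "?s n = 0" if "n \<notin> range (\<lambda>k. 2 * k)" for n
    proof -
      have "odd n" using that by (auto elim!: evenE)
      then show ?thesis by (simp add: s radial_coeff_def)
    qed
    ultimately show ?thesis using summable_mono_reindex[of "\<lambda>k. 2 * k" ?s] by simp
  qed
  then show ?thesis
    using nonneg_summable_on_levels[OF c(1), of "\<lambda>v. (norm (radial c v))\<^sup>2"]
    by (simp add: ell2_def radial_def)
qed

text \<open>At \<open>v\<close> in \<open>A\<close> all neighbors are on odd levels, where the
  function is 0. At other \<open>v\<close> the \<open>e - 1\<close> children together cancel the
  value at the parent.\<close>

lemma radial_kernel:
  assumes c: "c \<in> verts T" "c \<in> A" and "d < e"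
  shows "radial c \<in> ker_adj_op T"
proof -
  have "adj_op T (radial c) v = 0" if v: "v \<in> verts T" for v
  proof (cases "v \<in> A")
    case True
    have "radial c x = 0" if "x \<in> nbrs T v" for x
    proof -
      have "adj T v x" "x \<in> verts T" using that adj_verts by (auto simp: nbrs_def)
      then have "odd (gdist T c x)" using even_gdist[OF c(1)] True c alternating by blast
      then show ?thesis by (simp add: radial_def radial_coeff_def)
    qed
    then show ?thesis by (simp add: adj_op_def)
  next
    case False
    then have odd: "odd (gdist T c v)" using even_gdist[OF c(1) v] c by blast
    then obtain n where n: "gdist T c v = Suc n" "even n" by (cases "gdist T c v") auto
    then obtain y where y: "y \<in> level T c n" "v \<in> children c y"
      using level_Suc[OF c(1), of n] v by (auto simp: level_def)
    have "card (children c v) = e - 1"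
      using card_children[OF c(1) v] False c by auto
    moreover have "radial c x = radial_coeff (Suc (Suc n))" if "x \<in> children c v" for x
      using that n children_verts[OF that] by (auto simp: radial_def children_def)
    ultimately have "sum (radial c) (children c v) = - radial_coeff n"
      using \<open>d < e\<close> d_pos by (simp add: radial_coeff_step of_nat_diff)
    then show ?thesis
      using nbrs_child[OF c(1) y(2)] finite_children[OF v] radial_level[OF y(1)]
      by (simp add: adj_op_def)
  qed
  then show ?thesis using radial_ell2[OF assms] by (simp add: ker_adj_op_def)
qed

text \<open>On each even level \<open>w\<close> has the same sum as \<open>w c\<close> times the
  radial function. As that function is real and constant on levels, its inner product with
  \<open>w\<close> is its squared norm times \<open>w c\<close>.\<close>

lemma radial_orthogonal_imp_zero:
  assumes c: "c \<in> verts T" "c \<in> A" and "d < e" and w: "w \<in> ker_adj_op T"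
    and orth: "ell2_inner (verts T) (radial c) w = 0"
  shows "w c = 0"
proof -
  let ?n = "\<lambda>v. radial c v * radial c v"
  have w2: "(\<lambda>v. norm (w v * w v)) summable_on verts T"
    using w by (simp add: ker_adj_op_def ell2_def norm_mult power2_eq_square)
  have r2: "(\<lambda>v. norm (?n v)) summable_on verts T"
    using radial_ell2[OF c \<open>d < e\<close>] by (simp add: ell2_def norm_mult power2_eq_square)
  have "(\<lambda>v. radial c v * w v) summable_on verts T"
    using Infinite_Sum.abs_summable_product[OF r2 w2] by (rule abs_summable_summable)
  then have 1: "((\<lambda>n. \<Sum>v\<in>level T c n. radial c v * w v) has_sum 0) UNIV"
    using has_sum_levels[OF c(1), of "\<lambda>v. radial c v * w v"] orth
    by (simp add: ell2_inner_def cnj_radial)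
  have 2: "((\<lambda>n. sum ?n (level T c n)) has_sum infsum ?n (verts T)) UNIV"
    using has_sum_levels[OF c(1) abs_summable_summable[OF r2]] .
  \<comment> \<open>In the induction the factor \<open>e - 1\<close> in the growth of the level
    cancels the denominator of the coefficient, leaving the factor
    \<open>- branching (2 * k)\<close> of the recursion for \<open>w\<close>.\<close>
  have sum_w: "sum w (level T c (2 * k)) = of_nat (card (level T c (2 * k))) * radial_coeff (2 * k) * w c" for k
  proof (induction k)
    case 0
    show ?case by (simp add: level_0 c radial_coeff_def)
  next
    case (Suc k)
    have "sum w (level T c (2 * Suc k)) = - of_nat (branching (2 * k)) * sum w (level T c (2 * k))"
      using sum_level_kernel[OF c, of "2 * k" w] w by (simp add: ker_adj_op_def)
    also have "\<dots> = of_nat (card (level T c (2 * Suc k))) * radial_coeff (2 * Suc k) * w c"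
    proof -
      have "card (level T c (2 * Suc k)) = (e - 1) * branching (2 * k) * card (level T c (2 * k))"
        by (simp add: card_level_Suc[OF c]) (simp add: branching_def)
      moreover have "complex_of_nat e - 1 = of_nat (e - 1)" "complex_of_nat (e - 1) \<noteq> 0"
        using \<open>d < e\<close> d_pos by (auto simp: of_nat_diff)
      ultimately show ?thesis
        by (simp add: Suc.IH radial_coeff_step del: of_nat_diff)
    qed
    finally show ?case .
  qed
  have "(\<Sum>v\<in>level T c n. radial c v * w v) = sum ?n (level T c n) * w c" for n
  proof (cases "even n")
    case True
    then obtain k where k: "n = 2 * k" by blast
    have "(\<Sum>v\<in>level T c n. radial c v * w v) = radial_coeff n * sum w (level T c n)"
      by (simp add: radial_level sum_distrib_left)
    then show ?thesis using sum_w[of k] by (simp add: k radial_level)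
  qed (simp add: radial_level radial_coeff_def)
  then have "((\<lambda>n. sum ?n (level T c n) * w c) has_sum 0) UNIV" using 1 by simp
  then have "infsum ?n (verts T) * w c = 0"
    using has_sum_cmult_left[OF 2, of "w c"] has_sum_unique by blast
  \<comment> \<open>The terms are nonnegative reals, so a zero sum would force the term at
    \<open>c\<close> to vanish, but it is 1.\<close>
  moreover have "infsum ?n (verts T) \<noteq> 0"
  proof
    assume 0: "infsum ?n (verts T) = 0"
    have "?n v = complex_of_real ((norm (radial c v))\<^sup>2)" for v
      using complex_norm_square[of "radial c v"] by (simp add: cnj_radial)
    moreover have "(?n has_sum 0) (verts T)"
      using has_sum_infsum[OF abs_summable_summable[OF r2]] 0 by simp
    ultimately have "((\<lambda>v. (norm (radial c v))\<^sup>2) has_sum 0) (verts T)"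
      using has_sum_of_real_iff[where 'a = complex and c = 0 and A = "verts T"
          and f = "\<lambda>v. (norm (radial c v))\<^sup>2"] by simp
    then have "infsum (\<lambda>v. (norm (radial c v))\<^sup>2) (verts T) = 0"
      "(\<lambda>v. (norm (radial c v))\<^sup>2) summable_on verts T"
      by (auto intro: infsumI has_sum_imp_summable)
    then have "(norm (radial c c))\<^sup>2 = 0"
      using nonneg_infsum_le_0D[of "\<lambda>v. (norm (radial c v))\<^sup>2" "verts T" c] c by simp
    then show False using c by (simp add: radial_def gdist_self radial_coeff_def)
  qed
  ultimately show ?thesis by simp
qed

section \<open>Transitivity of the automorphism group\<close>

text \<open>A vertex is coded by the list of child indices on its path from the root, last step first.
  Which lists occur and which are adjacent does not depend on the root, so matching the codes with
  respect to two roots gives an automorphism.\<close>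

definition enumeration :: "'b set \<Rightarrow> nat \<Rightarrow> 'b" where
  "enumeration S = (SOME h. bij_betw h {..<card S} S)"

primrec decode :: "'v \<Rightarrow> nat list \<Rightarrow> 'v" where
  "decode c [] = c"
| "decode c (i # l) = enumeration (children c (decode c l)) i"

primrec address :: "nat list \<Rightarrow> bool" where
  "address [] = True"
| "address (i # l) = (address l \<and> i < branching (length l))"

lemma enumeration_bij:
  assumes "finite S"
  shows "bij_betw (enumeration S) {..<card S} S"
proof -
  have "\<exists>h. bij_betw h {..<card S} S"
    using ex_bij_betw_nat_finite[OF assms] by (simp add: atLeast0LessThan)
  then show ?thesis unfolding enumeration_def by (rule someI_ex)
qed

lemma enumeration_children:
  assumes "c \<in> verts T" "c \<in> A" "v \<in> level T c n"
  shows "bij_betw (enumeration (children c v)) {..<branching n} (children c v)"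
  using enumeration_bij[of "children c v"] finite_children[of v c] assms
    card_children_level[OF assms] by (simp add: level_def)

lemma decode_level:
  assumes "c \<in> verts T" "c \<in> A"
  shows "address l \<Longrightarrow> decode c l \<in> level T c (length l)"
proof (induction l)
  case (Cons i l)
  then show ?case
    using enumeration_children[OF assms, of "decode c l" "length l"]
    by (auto simp: level_Suc assms bij_betw_def)
qed (simp add: level_0 assms)

lemma decode_child:
  assumes "c \<in> verts T" "c \<in> A" "address (i # l)"
  shows "decode c (i # l) \<in> children c (decode c l)"
  using bij_betw_apply[OF enumeration_children[OF assms(1,2) decode_level[OF assms(1,2)]], of l i]
    assms(3) by simp

lemma child_decode:
  assumes "c \<in> verts T" "c \<in> A" "address l" "v \<in> children c (decode c l)"
  obtains i where "address (i # l)" "decode c (i # l) = v"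
proof -
  have "v \<in> enumeration (children c (decode c l)) ` {..<branching (length l)}"
    using enumeration_children[OF assms(1,2) decode_level[OF assms(1-3)]] assms(4)
    by (simp add: bij_betw_def)
  then show thesis using that assms(3) by auto
qed

lemma decode_surj:
  assumes c: "c \<in> verts T" "c \<in> A"
  shows "v \<in> level T c n \<Longrightarrow> \<exists>l. address l \<and> decode c l = v"
proof (induction n arbitrary: v)
  case 0
  then show ?case using c by (intro exI[of _ "[]"]) (simp add: level_0)
next
  case (Suc n)
  then obtain y where "y \<in> level T c n" "v \<in> children c y" using level_Suc[OF c(1)] by auto
  then obtain l where "address l" "v \<in> children c (decode c l)" using Suc.IH by blast
  then obtain i where "address (i # l)" "decode c (i # l) = v" by (rule child_decode[OF c])
  then show ?case by blast
qed

text \<open>Equal vertices lie on the same level, so the codes have equal length. Uniqueness of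
  parents reduces the claim to the tails, and injectivity of the enumeration settles the
  heads.\<close>

lemma decode_inj:
  assumes c: "c \<in> verts T" "c \<in> A"
  shows "address l \<Longrightarrow> address m \<Longrightarrow> decode c l = decode c m \<Longrightarrow> l = m"
proof (induction l arbitrary: m)
  case Nil
  then show ?case using decode_level[OF c, of m] level_0[OF c(1)]
    by (auto simp: level_def gdist_self)
next
  case (Cons i l)
  have "length m = Suc (length l)"
    using decode_level[OF c Cons.prems(1)] decode_level[OF c Cons.prems(2)] Cons.prems(3)
    by (simp add: level_def)
  then obtain j k where m: "m = j # k" by (cases m) auto
  have "decode c l = decode c k"
    using decode_child[OF c Cons.prems(1)] decode_child[OF c, of j k] Cons.prems m
      children_disjoint[OF c(1)] by metis
  then have "l = k" using Cons.IH Cons.prems m by simp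
  then show ?case
    using enumeration_children[OF c decode_level[OF c], of l] Cons.prems m
    by (auto simp: bij_betw_def inj_on_def)
qed

lemma decode_bij:
  assumes "c \<in> verts T" "c \<in> A"
  shows "bij_betw (decode c) (Collect address) (verts T)"
proof -
  have "decode c l \<in> verts T" if "address l" for l
    using decode_level[OF assms that] by (simp add: level_def)
  moreover have "v \<in> decode c ` Collect address" if "v \<in> verts T" for v
    using decode_surj[OF assms, of v "gdist T c v"] that by (auto simp: level_def)
  ultimately show ?thesis
    using decode_inj[OF assms] by (auto simp: bij_betw_def intro!: inj_onI)
qed

text \<open>Every edge joins a parent and a child. The right-hand side does not mention the root,
  which lets adjacency be transferred between two roots.\<close>

lemma decode_adj:
  assumes c: "c \<in> verts T" "c \<in> A" and "address l" "address m"
  shows "adj T (decode c l) (decode c m) \<longleftrightarrow> (\<exists>i. m = i # l \<or> l = i # m)"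
proof
  have child: "\<exists>i. m = i # l" if "decode c m \<in> children c (decode c l)" "address l" "address m" for l m
  proof -
    from that(2,1) obtain i where i: "address (i # l)" "decode c (i # l) = decode c m"
      by (rule child_decode[OF c])
    have "i # l = m" by (rule decode_inj[OF c i(1) that(3) i(2)])
    then show ?thesis by auto
  qed
  assume a: "adj T (decode c l) (decode c m)"
  then have "decode c m \<in> children c (decode c l) \<or> decode c l \<in> children c (decode c m)"
    using gdist_adj[OF c(1) a] adj_sym[OF a] by (auto simp: children_def nbrs_def)
  then show "\<exists>i. m = i # l \<or> l = i # m" using child assms by blast
next
  have child: "adj T (decode c l) (decode c (i # l))" if "address (i # l)" for i l
    using decode_child[OF c that] by (simp add: children_def nbrs_def del: decode.simps)
  assume "\<exists>i. m = i # l \<or> l = i # m"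
  then show "adj T (decode c l) (decode c m)"
    using child adj_sym[OF child] assms(3,4) by blast
qed

text \<open>Reading the code of a vertex from root \<open>x\<close> and decoding it from root
  \<open>c\<close> gives a map sending \<open>x\<close> to \<open>c\<close>. Preservation of code
  length yields the distance identity, which turns functions radial around \<open>c\<close> into
  functions radial around \<open>x\<close>.\<close>

lemma automorphism_exists:
  assumes c: "c \<in> verts T" "c \<in> A" and x: "x \<in> verts T" "x \<in> A"
  obtains \<sigma> where "\<sigma> permutes verts T"
    "\<And>y z. y \<in> verts T \<Longrightarrow> z \<in> verts T \<Longrightarrow> adj T (\<sigma> y) (\<sigma> z) \<longleftrightarrow> adj T y z"
    "\<And>y. y \<in> verts T \<Longrightarrow> gdist T c (\<sigma> y) = gdist T x y"
proof -
  define code where "code = the_inv_into (Collect address) (decode x)"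
  define \<sigma> where "\<sigma> v = (if v \<in> verts T then decode c (code v) else v)" for v
  have code: "bij_betw code (verts T) (Collect address)"
    unfolding code_def by (intro bij_betw_the_inv_into decode_bij x)
  have decode_code: "decode x (code v) = v" if "v \<in> verts T" for v
    unfolding code_def using decode_bij[OF x] that by (rule f_the_inv_into_f_bij_betw)
  have address: "address (code v)" if "v \<in> verts T" for v
    using code that by (auto simp: bij_betw_def)
  have "bij_betw \<sigma> (verts T) (verts T)"
    using bij_betw_trans[OF code decode_bij[OF c]]
    by (rule bij_betw_cong[THEN iffD1, rotated]) (simp add: \<sigma>_def)
  then have "\<sigma> permutes verts T" by (rule bij_imp_permutes) (simp add: \<sigma>_def)
  moreover have "adj T (\<sigma> y) (\<sigma> z) \<longleftrightarrow> adj T y z" if "y \<in> verts T" "z \<in> verts T" for y z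
    using decode_adj[OF c address address, OF that] decode_adj[OF x address address, OF that]
    by (simp add: \<sigma>_def that decode_code)
  moreover have "gdist T c (\<sigma> y) = gdist T x y" if "y \<in> verts T" for y
    using decode_level[OF c address[OF that]] decode_level[OF x address[OF that]]
    by (simp add: \<sigma>_def that decode_code level_def)
  ultimately show thesis by (rule that)
qed

end

text \<open>This makes the vanishing result, stated for roots in \<open>A\<close>, available at the
  green vertices.\<close>

lemma semiregular_tree_swap:
  assumes "semiregular_tree T A d e"
  shows "semiregular_tree T (- A) e d"
  using assms by (auto simp: semiregular_tree_def)

section \<open>The rg-model\<close>

text \<open>A covering is bijective on neighborhoods, so degrees and alternation of colors are
  inherited from the complete bipartite base graph.\<close>

lemma rg_cover_semiregular:
  assumes "0 < r" "0 < g" "universal_cover (rg_graph r g) T p"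
  shows "semiregular_tree T {v. lifted_color p v = Red} g r"
proof
  have cov: "covering_map (rg_graph r g) T p" and tr: "tree T"
    using assms(3) by (auto simp: universal_cover_def)
  show "tree T" by (fact tr)
  have bij: "bij_betw p (nbrs T x) (nbrs (rg_graph r g) (p x))" if "x \<in> verts T" for x
    using cov that by (simp add: covering_map_def)
  have base: "p x \<in> verts (rg_graph r g)" if "x \<in> verts T" for x
    using cov that by (auto simp: covering_map_def)
  have red: "nbrs (rg_graph r g) (Red, i) = {Green} \<times> {..<g}"
    if "(Red, i) \<in> verts (rg_graph r g)" for i
    using that by (auto simp: nbrs_def rg_graph_def)
  have green: "nbrs (rg_graph r g) (Green, i) = {Red} \<times> {..<r}"
    if "(Green, i) \<in> verts (rg_graph r g)" for i
    using that by (auto simp: nbrs_def rg_graph_def)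
  show "x \<in> {v. lifted_color p v = Red} \<longleftrightarrow> y \<notin> {v. lifted_color p v = Red}"
    if "adj T x y" for x y
  proof -
    have "x \<in> verts T" using tr that by (auto simp: tree_def simple_graph_def)
    then have "p y \<in> nbrs (rg_graph r g) (p x)"
      using bij that by (auto simp: bij_betw_def nbrs_def)
    then have "fst (p x) \<noteq> fst (p y)" by (simp add: nbrs_def rg_graph_def Let_def)
    then show ?thesis by (cases "fst (p x)"; cases "fst (p y)") (auto simp: lifted_color_def)
  qed
  show "card (nbrs T x) = g" if "x \<in> verts T" "x \<in> {v. lifted_color p v = Red}" for x
    using bij_betw_same_card[OF bij[OF that(1)]] base[OF that(1)] red that(2)
    by (cases "p x") (simp add: lifted_color_def card_cartesian_product_singleton)
  show "card (nbrs T x) = r" if x: "x \<in> verts T" "x \<notin> {v. lifted_color p v = Red}" for x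
  proof -
    obtain i where "p x = (Green, i)"
      using x(2) by (cases "p x"; cases "fst (p x)") (auto simp: lifted_color_def)
    then show ?thesis
      using bij_betw_same_card[OF bij[OF x(1)]] base[OF x(1)] green
      by (simp add: card_cartesian_product_singleton)
  qed
qed (use assms in auto)

theorem theorem4p1:
  fixes r g :: nat
    and T :: "'v sgraph"
    and p :: "'v \<Rightarrow> color \<times> nat"
    and c :: 'v
    and u :: "'v \<Rightarrow> complex"
  assumes "0 < g" and "g < r"
    and "universal_cover (rg_graph r g) T p"
    and "c \<in> verts T" and "lifted_color p c = Red"
    and "\<And>k v. k \<ge> 1 \<Longrightarrow> v \<in> level T c (2 * k - 1) \<Longrightarrow> u v = 0"
    and "\<And>k v. v \<in> level T c (2 * k) \<Longrightarrow> u v = (- (1 / (of_nat r - 1))) ^ k"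
    and "\<And>v. v \<notin> verts T \<Longrightarrow> u v = 0"
  shows "u \<in> ker_adj_op T \<and>
    (\<forall>w \<in> ker_adj_op T.
       ell2_inner (verts T) u w = 0 \<and>
       (\<forall>\<sigma> \<in> rg_symmetries T p. ell2_inner (verts T) (u \<circ> \<sigma>) w = 0) \<longrightarrow>
       w = (\<lambda>_. 0))"
proof -
  let ?R = "{v. lifted_color p v = Red}"
  interpret red: semiregular_tree T ?R g r
    using assms(1-3) by (intro rg_cover_semiregular) auto
  interpret green: semiregular_tree T "- ?R" r g
    by (rule semiregular_tree_swap) unfold_locales
  have c: "c \<in> verts T" "c \<in> ?R" using assms(4,5) by auto
  have u: "u = red.radial c"
  proof
    fix v
    show "u v = red.radial c v"
    proof (cases "v \<in> verts T")
      case True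
      let ?n = "gdist T c v"
      have v: "v \<in> level T c ?n" using True by (simp add: level_def)
      show ?thesis
      proof (cases "even ?n")
        case even: True
        then show ?thesis using assms(7)[of v "?n div 2"] v True
          by (simp add: red.radial_def red.radial_coeff_def)
      next
        case odd: False
        \<comment> \<open>The odd levels are indexed as \<open>2 * k - 1\<close> from
          \<open>k = 1\<close>, hence the shift by one.\<close>
        then have "?n = 2 * (?n div 2 + 1) - 1" by presburger
        then have "u v = 0" using assms(6)[of "?n div 2 + 1" v] v by simp
        then show ?thesis using odd by (simp add: red.radial_def red.radial_coeff_def)
      qed
    qed (simp add: assms(8) red.radial_def)
  qed
  have "w v = 0"
    if w: "w \<in> ker_adj_op T"
      and orth: "\<forall>\<sigma>\<in>rg_symmetries T p. ell2_inner (verts T) (u \<circ> \<sigma>) w = 0" for w v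
  proof -
    consider "v \<notin> verts T" | "v \<in> verts T" "v \<notin> ?R" | "v \<in> verts T" "v \<in> ?R" by blast
    then show ?thesis
    proof cases
      case 1
      then show ?thesis using w by (simp add: ker_adj_op_def ell2_def)
    next
      case 2
      \<comment> \<open>Green vertices have the larger degree \<open>r\<close>, and
        \<open>0 < g < r\<close> gives \<open>2 \<le> r\<close>.\<close>
      then show ?thesis using green.kernel_vanishes_at_larger_degree[OF _ _ _ _ w, of v] assms(1,2) by simp
    next
      case 3
      obtain \<sigma> where \<sigma>: "\<sigma> permutes verts T"
        "\<And>y z. y \<in> verts T \<Longrightarrow> z \<in> verts T \<Longrightarrow> adj T (\<sigma> y) (\<sigma> z) \<longleftrightarrow> adj T y z"
        "\<And>y. y \<in> verts T \<Longrightarrow> gdist T c (\<sigma> y) = gdist T v y"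
        by (rule red.automorphism_exists[OF c 3]) blast
      \<comment> \<open>Color is determined by the parity of the distance to a red vertex, and both
        \<open>c\<close> and \<open>v\<close> are red.\<close>
      have "lifted_color p (\<sigma> y) = lifted_color p y" if "y \<in> verts T" for y
      proof -
        have "\<sigma> y \<in> verts T" using permutes_in_image[OF \<sigma>(1)] that by blast
        then have "\<sigma> y \<in> ?R \<longleftrightarrow> y \<in> ?R"
          using red.even_gdist[OF c(1), of "\<sigma> y"] red.even_gdist[OF 3(1) that] \<sigma>(3)[OF that] c 3
          by simp
        then show ?thesis by (cases "lifted_color p y"; cases "lifted_color p (\<sigma> y)") auto
      qed
      then have "\<sigma> \<in> rg_symmetries T p" using \<sigma> by (simp add: rg_symmetries_def)
      moreover have "u \<circ> \<sigma> = red.radial v"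
        using \<sigma>(3) permutes_in_image[OF \<sigma>(1)] by (auto simp: u red.radial_def)
      ultimately have "ell2_inner (verts T) (red.radial v) w = 0" using orth by metis
      then show ?thesis using red.radial_orthogonal_imp_zero[OF 3 assms(2) w] by blast
    qed
  qed
  then show ?thesis using red.radial_kernel[OF c assms(2)] by (auto simp: u)
qed

end
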